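(* Let $p$ be a prime and $r\ge 1$ an integer such that $q=p^r\equiv 3 \pmod 4$, and put $t=(q-1)/2$. Let $G = C_p^r\rtimes C_t$ be the semidirect product in which $C_p^r$ is identified with the additive group of $\mathrm{GF}(q)$, $C_t$ is identified with the multiplicative group of nonzero squares of $\mathrm{GF}(q)$, and $C_t$ acts on $C_p^r$ by multiplication. Then the triangular graph $T_q$ is isomorphic to a Cayley graph of $G$; that is, there is a subset $S\subseteq G$ with $1\notin S$ and $S=\{s^{-1}:s\in S\}$ such that $T_q\cong \mathrm{Cay}(G,S)$.
   Context: For an integer $n$, the triangular graph $T_n$ has as vertices the $2$-element subsets of a fixed set of size $n$, two distinct vertices being adjacent if and only if they share exactly one element. For a finite group $G$ and $S\subseteq G$ with $1\notin S$ and $S$ closed under inverses, $\mathrm{Cay}(G,S)$ is the graph with vertex set $G$ in which $x\sim y$ if and only if $xy^{-1}\in S$. $C_m$ denotes the cyclic group of order $m$, and $C_p^r$ the direct product of $r$ copies of $C_p$. *)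

theory Defs
  imports "HOL-Algebra.Multiplicative_Group" "HOL-Algebra.Product_Groups" "HOL-Algebra.Bij"
    "HOL-Number_Theory.Cong" "Graph_Theory.Graph_Theory"
begin

text \<open>An undirected simple graph is represented by its symmetric, loop-free set of arcs, as in
  the locale \<open>pair_graph\<close>.\<close>

definition triangular_graph :: "nat \<Rightarrow> nat set pair_pre_digraph"
  where "triangular_graph n =
    (let V = {A. A \<subseteq> {..<n} \<and> card A = 2}
     in \<lparr>pverts = V, parcs = {(A, B) \<in> V \<times> V. A \<noteq> B \<and> card (A \<inter> B) = 1}\<rparr>)"

definition cayley_graph :: "('a, 'b) monoid_scheme \<Rightarrow> 'a set \<Rightarrow> 'a pair_pre_digraph"
  where "cayley_graph G S =
    \<lparr>pverts = carrier G,
     parcs = {(x, y) \<in> carrier G \<times> carrier G. x \<otimes>\<^bsub>G\<^esub> inv\<^bsub>G\<^esub> y \<in> S}\<rparr>"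

definition semidirect_product ::
    "('a, 'c) monoid_scheme \<Rightarrow> ('b, 'd) monoid_scheme \<Rightarrow> ('b \<Rightarrow> 'a \<Rightarrow> 'a) \<Rightarrow> ('a \<times> 'b) monoid"
  where "semidirect_product N H \<theta> =
    \<lparr>carrier = carrier N \<times> carrier H,
     monoid.mult = (\<lambda>(n, h) (n', h'). (n \<otimes>\<^bsub>N\<^esub> \<theta> h n', h \<otimes>\<^bsub>H\<^esub> h')),
     one = (\<one>\<^bsub>N\<^esub>, \<one>\<^bsub>H\<^esub>)\<rparr>"

abbreviation elementary_abelian_group :: "nat \<Rightarrow> nat \<Rightarrow> (nat \<Rightarrow> int) monoid"
  where "elementary_abelian_group p r \<equiv> product_group {..<r} (\<lambda>_. integer_mod_group p)"

definition nonzero_squares_group :: "('a, 'b) ring_scheme \<Rightarrow> 'a monoid"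
  where "nonzero_squares_group F =
    (mult_of F)\<lparr>carrier := {x \<otimes>\<^bsub>F\<^esub> x | x. x \<in> carrier (mult_of F)}\<rparr>"

text \<open>Multiplication in \<open>F\<close>, transported to a group \<open>P\<close> identified with the additive group of \<open>F\<close>
  by \<open>\<phi>\<close> and to a group whose elements are identified by \<open>\<psi>\<close> with elements of \<open>F\<close>.
  The maps are restricted to \<open>carrier P\<close> because \<open>AutoGroup\<close> consists of extensional functions.\<close>

definition multiplication_action ::
    "('a, 'b) ring_scheme \<Rightarrow> ('p, 'c) monoid_scheme \<Rightarrow> ('p \<Rightarrow> 'a) \<Rightarrow> ('q \<Rightarrow> 'a) \<Rightarrow> 'q \<Rightarrow> 'p \<Rightarrow> 'p"
  where "multiplication_action F P \<phi> \<psi> c =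
    (\<lambda>x\<in>carrier P. inv_into (carrier P) \<phi> (\<psi> c \<otimes>\<^bsub>F\<^esub> \<phi> x))"


lemma (in comm_group) elementary_abelian_group_mon:
  assumes p: "prime p" and ord: "order G = p ^ r"
    and exp: "\<And>x. x \<in> carrier G \<Longrightarrow> x [^] p = \<one>"
  shows "m \<le> r \<Longrightarrow> \<exists>h. h \<in> mon (elementary_abelian_group p m) G"
proof (induction m)
  case 0
  have "(\<lambda>_. \<one>) \<in> mon (elementary_abelian_group p 0) G"
    by (auto simp: mon_def hom_def)
  then show ?case by blast
next
  case (Suc m)
  let ?E = "elementary_abelian_group p"
  have p0: "p > 0" using p prime_gt_0_nat by blast
  have grE: "group (?E k)" for k by simp
  obtain h where h: "h \<in> hom (?E m) G" and inj: "inj_on h (carrier (?E m))"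
    using Suc by (auto simp: mon_def)
  interpret hm: group_hom "?E m" G h
    using h grE by (simp add: group_hom_def group_hom_axioms_def)
  let ?I = "h ` carrier (?E m)"
  have subI: "subgroup ?I G" by (rule hm.img_is_subgroup)
  have fin: "finite (carrier G)"
    using ord p0 by (simp add: order_def card_ge_0_finite)
  have "card ?I = p ^ m"
    using inj p0 by (simp add: card_image card_PiE carrier_integer_mod_group)
  also have "\<dots> < p ^ r"
    using Suc.prems prime_gt_1_nat[OF p] by (intro power_strict_increasing) auto
  finally have "?I \<noteq> carrier G" using ord by (auto simp: order_def)
  then obtain v where v: "v \<in> carrier G" "v \<notin> ?I"
    using subgroup.subset[OF subI] by blast
  have vp: "v [^] (int p) = \<one>"
    using exp[OF v(1)] by (simp add: int_pow_int)
  have vmod: "v [^] (k mod int p) = v [^] k" for k :: int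
  proof -
    have "v [^] k = v [^] (int p * (k div int p) + k mod int p)" by simp
    also have "\<dots> = (v [^] int p) [^] (k div int p) \<otimes> v [^] (k mod int p)"
      using v by (simp only: int_pow_mult int_pow_pow)
    finally show ?thesis using v vp by simp
  qed
  define h' where "h' c = h (restrict c {..<m}) \<otimes> v [^] (c m :: int)" for c
  have res: "restrict c {..<m} \<in> carrier (?E m)" if "c \<in> carrier (?E (Suc m))" for c
    using that by (auto simp: PiE_iff)
  have hom: "h' \<in> hom (?E (Suc m)) G"
  proof (rule homI)
    fix c assume "c \<in> carrier (?E (Suc m))"
    then show "h' c \<in> carrier G" using res v by (simp add: h'_def del: carrier_product_group)
  next
    fix c d assume c: "c \<in> carrier (?E (Suc m))" and d: "d \<in> carrier (?E (Suc m))"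
    have "restrict (c \<otimes>\<^bsub>?E (Suc m)\<^esub> d) {..<m} = restrict c {..<m} \<otimes>\<^bsub>?E m\<^esub> restrict d {..<m}"
      by (auto simp: fun_eq_iff)
    moreover have "(c \<otimes>\<^bsub>?E (Suc m)\<^esub> d) m = (c m + d m) mod int p" by simp
    ultimately have "h' (c \<otimes>\<^bsub>?E (Suc m)\<^esub> d) =
      (h (restrict c {..<m}) \<otimes> h (restrict d {..<m})) \<otimes> (v [^] c m \<otimes> v [^] d m)"
      using v hm.hom_mult[OF res[OF c] res[OF d]] by (simp only: h'_def vmod int_pow_mult)
    also have "\<dots> = h' c \<otimes> h' d"
      using v hm.hom_closed[OF res[OF c]] hm.hom_closed[OF res[OF d]]
      by (simp add: h'_def m_ac del: carrier_product_group)
    finally show "h' (c \<otimes>\<^bsub>?E (Suc m)\<^esub> d) = h' c \<otimes> h' d" .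
  qed
  interpret hm': group_hom "?E (Suc m)" G h'
    using hom grE by (simp add: group_hom_def group_hom_axioms_def)
  have "inj_on h' (carrier (?E (Suc m)))"
  proof (rule hm'.inj_on_one_iff[THEN iffD2], intro allI impI)
    fix c assume c: "c \<in> carrier (?E (Suc m))" and one: "h' c = \<one>"
    have cm: "0 \<le> c m" "c m < int p" using c p0 by (auto simp: carrier_integer_mod_group PiE_iff)
    have c0: "c m = 0"
    proof (rule ccontr)
      assume "c m \<noteq> 0"
      with cm have "\<not> int p dvd c m" by (auto dest: zdvd_imp_le)
      then have "coprime (int p) (c m)"
        using p by (simp add: prime_imp_coprime)
      then have "coprime (c m) (int p)" by (simp add: coprime_commute)
      then obtain u w where uw: "u * c m + w * int p = 1"
        using bezout_int[of "c m" "int p"] by (auto simp: coprime_iff_gcd_eq_1)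
      have "v [^] c m = inv (h (restrict c {..<m}))"
        using one v hm.hom_closed[OF res[OF c]] inv_equality[of "v [^] c m" "h (restrict c {..<m})"]
        by (simp only: h'_def m_comm int_pow_closed)
      then have "v [^] c m \<in> ?I"
        using subgroup.m_inv_closed[OF subI] res[OF c] by simp
      then have "(v [^] c m) [^] u \<in> ?I"
        using subgroup_int_pow_closed[OF subI] by blast
      also have "(v [^] c m) [^] u = v [^] (c m * u) \<otimes> (v [^] int p) [^] w"
        using v vp by (simp add: int_pow_pow)
      also have "\<dots> = v [^] (u * c m + w * int p)"
        using v by (simp only: int_pow_pow int_pow_mult mult.commute)
      also have "\<dots> = v" using uw v by simp
      finally show False using v by simp
    qed
    then have "h (restrict c {..<m}) = \<one>"
      using one v hm.hom_closed[OF res[OF c]] by (simp add: h'_def)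
    then have "restrict c {..<m} = \<one>\<^bsub>?E m\<^esub>"
      using inj res[OF c] hm.inj_on_one_iff by blast
    then have "c i = 0" if "i < m" for i
      using that by (metis lessThan_iff one_integer_mod_group one_product_group restrict_apply)
    then show "c = \<one>\<^bsub>?E (Suc m)\<^esub>"
      using c c0 by (auto simp: PiE_iff extensional_def fun_eq_iff less_Suc_eq)
  qed
  with hom show ?case unfolding mon_def by blast
qed

lemma (in comm_group) elementary_abelian_group_iso:
  assumes p: "prime p" and ord: "order G = p ^ r"
    and exp: "\<And>x. x \<in> carrier G \<Longrightarrow> x [^] p = \<one>"
  shows "\<exists>h. h \<in> iso (elementary_abelian_group p r) G"
proof -
  obtain h where h: "h \<in> hom (elementary_abelian_group p r) G"
      and inj: "inj_on h (carrier (elementary_abelian_group p r))"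
    using elementary_abelian_group_mon[OF assms, of r] by (auto simp: mon_def)
  have p0: "p > 0" using p prime_gt_0_nat by blast
  have fin: "finite (carrier G)"
    using ord p0 by (simp add: order_def card_ge_0_finite)
  have "card (h ` carrier (elementary_abelian_group p r)) = p ^ r"
    using inj p0 by (simp add: card_image card_PiE carrier_integer_mod_group)
  then have "h ` carrier (elementary_abelian_group p r) = carrier G"
    using ord fin hom_carrier[OF h] by (simp add: order_def card_subset_eq)
  then show ?thesis using h inj by (auto simp: iso_def bij_betw_def)
qed

text \<open>The additive group of a field with \<open>p ^ r\<close> elements can be identified with the direct
  product of \<open>r\<close> cyclic groups of order \<open>p\<close>.\<close>

lemma (in field) additive_group_identification:
  assumes p: "prime p" and ord: "order R = p ^ r"
  shows "\<exists>\<phi>. \<phi> \<in> iso (elementary_abelian_group p r) (add_monoid R)"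
proof -
  have p0: "p > 0" using p prime_gt_0_nat by blast
  have ordA: "order (add_monoid R) = p ^ r" using ord by (simp add: order_def)
  have eq: "[n] \<cdot> x = ([n] \<cdot> \<one>) \<otimes> x" if "x \<in> carrier R" for n :: nat and x
    using that by (induction n) (auto simp: l_distr)
  have pow: "[(p ^ k)] \<cdot> \<one> = ([p] \<cdot> \<one>) [^] k" for k
  proof (induction k)
    case (Suc k)
    have "[(p ^ Suc k)] \<cdot> \<one> = [(p ^ k)] \<cdot> ([p] \<cdot> \<one>)"
      by (simp add: add.nat_pow_pow)
    also have "\<dots> = ([(p ^ k)] \<cdot> \<one>) \<otimes> ([p] \<cdot> \<one>)"
      by (rule eq) simp
    finally show ?case using Suc by simp
  qed simp
  have "[(p ^ r)] \<cdot> \<one> = \<zero>"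
    using group.pow_order_eq_1[OF a_group, of \<one>] ordA by (simp add: add_pow_def)
  then have "([p] \<cdot> \<one>) [^] r = \<zero>" using pow by simp
  then have p1: "[p] \<cdot> \<one> = \<zero>"
    by (induction r) (auto simp: integral_iff)
  show ?thesis
  proof (rule comm_group.elementary_abelian_group_iso[OF a_comm_group p ordA])
    fix x assume "x \<in> carrier (add_monoid R)"
    then show "x [^]\<^bsub>add_monoid R\<^esub> p = \<one>\<^bsub>add_monoid R\<^esub>"
      using eq[of x p] p1 by (simp add: add_pow_def)
  qed
qed

text \<open>The nonzero squares of a finite field of odd order \<open>q\<close> can be identified with the cyclic
  group of order \<open>(q - 1) / 2\<close>.\<close>

lemma (in field) nonzero_squares_group_identification:
  assumes odd: "odd (order R)"
  shows "\<exists>\<psi>. \<psi> \<in> iso (integer_mod_group ((order R - 1) div 2)) (nonzero_squares_group R)"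
proof -
  define t where "t = (order R - 1) div 2"
  have "order R \<noteq> 0" using odd by (metis even_zero)
  then have fin: "finite (carrier R)" by (metis order_def card.infinite)
  interpret M: comm_group "mult_of R" by (rule units_comm_group[folded mult_of_is_Units]) 
  have finM: "finite (carrier (mult_of R))" using fin by simp
  have ordM: "order (mult_of R) = 2 * t"
    using odd fin unfolding order_def t_def by (auto simp: card_Diff_singleton)
  obtain g where g: "g \<in> carrier (mult_of R)"
      and gen: "carrier (mult_of R) = {g [^] i | i::nat. i \<in> UNIV}"
    using finite_field_mult_group_has_gen[OF fin] by blast
  have "carrier (mult_of R) = generate (mult_of R) {g}"
    using gen M.generate_pow_on_finite_carrier[OF finM g] by (auto simp: nat_pow_mult_of)
  then have ordg: "M.ord g = 2 * t"
    using M.generate_pow_card[OF g] ordM by (simp add: order_def)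
  have t0: "t > 0"
    using ordM finM g by (metis M.order_gt_0_iff_finite nat_0_less_mult_iff)
  define s where "s = g [^]\<^bsub>mult_of R\<^esub> (2::nat)"
  have s: "s \<in> carrier (mult_of R)" unfolding s_def using g by (rule M.nat_pow_closed)
  have ords: "M.ord s = t"
    using M.ord_pow_gen[OF g, of 2] ordg t0 by (simp add: s_def)
  define \<psi> where "\<psi> k = s [^]\<^bsub>mult_of R\<^esub> (k :: int)" for k
  have eq: "\<psi> k = \<psi> l \<longleftrightarrow> int t dvd l - k" for k l
    using M.int_pow_eq[OF s] ords by (simp add: \<psi>_def)
  have md: "\<psi> (k mod int t) = \<psi> k" for k
    by (simp add: eq)
  have sq: "\<psi> (int i) = (g [^]\<^bsub>mult_of R\<^esub> i) \<otimes>\<^bsub>mult_of R\<^esub> (g [^]\<^bsub>mult_of R\<^esub> i)" for i :: nat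
    using g by (simp only: \<psi>_def s_def int_pow_int M.nat_pow_pow M.nat_pow_mult mult_2)
  have car: "carrier (nonzero_squares_group R) = range (\<lambda>i::nat. \<psi> (int i))"
  proof -
    have "carrier (mult_of R) = range (\<lambda>i::nat. g [^]\<^bsub>mult_of R\<^esub> i)"
      using gen by (auto simp: nat_pow_mult_of)
    then show ?thesis
      unfolding nonzero_squares_group_def by (auto simp: sq simp del: carrier_mult_of)
  qed
  have im: "\<psi> ` {0..<int t} = carrier (nonzero_squares_group R)"
  proof
    show "\<psi> ` {0..<int t} \<subseteq> carrier (nonzero_squares_group R)"
      unfolding car by (auto intro!: rev_image_eqI[of "nat _"])
    show "carrier (nonzero_squares_group R) \<subseteq> \<psi> ` {0..<int t}"
    proof
      fix x assume "x \<in> carrier (nonzero_squares_group R)"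
      then obtain i :: nat where "x = \<psi> (int i)" unfolding car by auto
      then have "x = \<psi> (int i mod int t)" by (simp only: md)
      then show "x \<in> \<psi> ` {0..<int t}" using t0 by (intro image_eqI) auto
    qed
  qed
  have inj: "inj_on \<psi> {0..<int t}"
  proof (rule inj_onI)
    fix k l assume "k \<in> {0..<int t}" "l \<in> {0..<int t}" "\<psi> k = \<psi> l"
    then have "l mod int t = k mod int t" "k mod int t = k" "l mod int t = l"
      by (simp_all add: eq mod_eq_dvd_iff[symmetric])
    then show "k = l" by simp
  qed
  have "\<psi> \<in> iso (integer_mod_group t) (nonzero_squares_group R)"
  proof (rule isoI)
    show "\<psi> \<in> hom (integer_mod_group t) (nonzero_squares_group R)"
    proof (rule homI)
      fix k assume "k \<in> carrier (integer_mod_group t)"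
      then show "\<psi> k \<in> carrier (nonzero_squares_group R)"
        using im t0 by (auto simp: carrier_integer_mod_group)
    next
      fix k l
      have "\<psi> (k \<otimes>\<^bsub>integer_mod_group t\<^esub> l) = \<psi> (k + l)" by (simp add: md)
      also have "\<dots> = \<psi> k \<otimes>\<^bsub>mult_of R\<^esub> \<psi> l" using s by (simp only: \<psi>_def M.int_pow_mult)
      finally show "\<psi> (k \<otimes>\<^bsub>integer_mod_group t\<^esub> l) = \<psi> k \<otimes>\<^bsub>nonzero_squares_group R\<^esub> \<psi> l"
        by (simp add: nonzero_squares_group_def)
    qed
    show "bij_betw \<psi> (carrier (integer_mod_group t)) (carrier (nonzero_squares_group R))"
      using im inj t0 by (simp add: bij_betw_def carrier_integer_mod_group)
  qed
  then show ?thesis unfolding t_def by blast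
qed

lemma group_semidirect_product:
  assumes N: "group N" and H: "group H" and \<theta>: "\<theta> \<in> hom H (AutoGroup N)"
  shows "group (semidirect_product N H \<theta>)"
proof -
  interpret N: group N by (rule N)
  interpret H: group H by (rule H)
  have auto: "\<theta> h \<in> Bij.auto N" if "h \<in> carrier H" for h
    using hom_in_carrier[OF \<theta> that] by (simp add: AutoGroup_def)
  then have bij: "\<theta> h \<in> Bij (carrier N)" if "h \<in> carrier H" for h
    using that by (auto simp: Bij.auto_def)
  have cl: "\<theta> h n \<in> carrier N" if "h \<in> carrier H" "n \<in> carrier N" for h n
    using Bij_imp_funcset[OF bij] that by blast
  have mult: "\<theta> h (n \<otimes>\<^bsub>N\<^esub> n') = \<theta> h n \<otimes>\<^bsub>N\<^esub> \<theta> h n'"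
    if "h \<in> carrier H" "n \<in> carrier N" "n' \<in> carrier N" for h n n'
    using auto that by (auto simp: Bij.auto_def hom_def)
  have act: "\<theta> (h \<otimes>\<^bsub>H\<^esub> h') n = \<theta> h (\<theta> h' n)"
    if "h \<in> carrier H" "h' \<in> carrier H" "n \<in> carrier N" for h h' n
    using hom_mult[OF \<theta>] that bij by (simp add: AutoGroup_def BijGroup_def compose_def)
  have one: "\<theta> \<one>\<^bsub>H\<^esub> n = n" if "n \<in> carrier N" for n
  proof -
    have "\<theta> \<one>\<^bsub>H\<^esub> (\<theta> \<one>\<^bsub>H\<^esub> n) = \<theta> \<one>\<^bsub>H\<^esub> n"
      using act[of "\<one>\<^bsub>H\<^esub>" "\<one>\<^bsub>H\<^esub>" n] that by simp
    moreover have "inj_on (\<theta> \<one>\<^bsub>H\<^esub>) (carrier N)"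
      using bij[OF H.one_closed] by (simp add: Bij_def bij_betw_def)
    ultimately show ?thesis using cl that by (meson H.one_closed inj_onD)
  qed
  show ?thesis
  proof (rule groupI)
    fix x assume "x \<in> carrier (semidirect_product N H \<theta>)"
    then obtain n h where x: "x = (n, h)" "n \<in> carrier N" "h \<in> carrier H"
      by (auto simp: semidirect_product_def)
    let ?y = "(\<theta> (inv\<^bsub>H\<^esub> h) (inv\<^bsub>N\<^esub> n), inv\<^bsub>H\<^esub> h)"
    have "\<theta> (inv\<^bsub>H\<^esub> h) (inv\<^bsub>N\<^esub> n) \<otimes>\<^bsub>N\<^esub> \<theta> (inv\<^bsub>H\<^esub> h) n = \<theta> (inv\<^bsub>H\<^esub> h) \<one>\<^bsub>N\<^esub>"
      using x by (simp flip: mult)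
    also have "\<dots> = \<one>\<^bsub>N\<^esub>"
      using x cl mult by (metis H.inv_closed N.l_cancel_one N.one_closed N.r_one)
    finally have "?y \<otimes>\<^bsub>semidirect_product N H \<theta>\<^esub> x = \<one>\<^bsub>semidirect_product N H \<theta>\<^esub>"
      using x by (simp add: semidirect_product_def)
    moreover have "?y \<in> carrier (semidirect_product N H \<theta>)"
      using x cl by (simp add: semidirect_product_def)
    ultimately show "\<exists>y\<in>carrier (semidirect_product N H \<theta>).
        y \<otimes>\<^bsub>semidirect_product N H \<theta>\<^esub> x = \<one>\<^bsub>semidirect_product N H \<theta>\<^esub>"
      by blast
  qed (auto simp: semidirect_product_def cl one mult act N.m_assoc H.m_assoc)
qed

lemma (in field) multiplication_action_hom:
  assumes P: "group P" and C: "group C"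
    and \<phi>: "\<phi> \<in> iso P (add_monoid R)" and \<psi>: "\<psi> \<in> hom C (mult_of R)"
  shows "multiplication_action R P \<phi> \<psi> \<in> hom C (AutoGroup P)"
proof -
  interpret P: group P by (rule P)
  interpret C: group C by (rule C)
  define \<theta> where "\<theta> = multiplication_action R P \<phi> \<psi>"
  have bij: "bij_betw \<phi> (carrier P) (carrier R)"
    and add: "\<And>x y. x \<in> carrier P \<Longrightarrow> y \<in> carrier P \<Longrightarrow> \<phi> (x \<otimes>\<^bsub>P\<^esub> y) = \<phi> x \<oplus> \<phi> y"
    using \<phi> by (auto simp: iso_def hom_def)
  have \<phi>c: "\<phi> x \<in> carrier R" if "x \<in> carrier P" for x
    using bij that by (auto simp: bij_betw_def)
  have inj: "x = y" if "\<phi> x = \<phi> y" "x \<in> carrier P" "y \<in> carrier P" for x y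
    using bij that by (auto simp: bij_betw_def dest: inj_onD)
  have \<psi>c: "\<psi> c \<in> carrier R" "\<psi> c \<noteq> \<zero>" if "c \<in> carrier C" for c
    using hom_in_carrier[OF \<psi> that] by auto
  have \<psi>m: "\<psi> (c \<otimes>\<^bsub>C\<^esub> d) = \<psi> c \<otimes> \<psi> d" if "c \<in> carrier C" "d \<in> carrier C" for c d
    using hom_mult[OF \<psi> that] by simp
  have cl: "\<theta> c x \<in> carrier P" and \<phi>\<theta>: "\<phi> (\<theta> c x) = \<psi> c \<otimes> \<phi> x"
    if "c \<in> carrier C" "x \<in> carrier P" for c x
    using that \<phi>c \<psi>c bij
    by (auto simp: \<theta>_def multiplication_action_def bij_betw_def inv_into_into f_inv_into_f)
  have ext: "\<theta> c \<in> extensional (carrier P)" for c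
    by (simp add: \<theta>_def multiplication_action_def)
  have hm: "\<theta> c \<in> hom P P" if c: "c \<in> carrier C" for c
  proof (rule homI)
    fix x y assume "x \<in> carrier P" "y \<in> carrier P"
    with c show "\<theta> c (x \<otimes>\<^bsub>P\<^esub> y) = \<theta> c x \<otimes>\<^bsub>P\<^esub> \<theta> c y"
      by (intro inj) (auto simp: cl \<phi>\<theta> add r_distr \<psi>c \<phi>c)
  qed (use c cl in auto)
  have bj: "\<theta> c \<in> Bij (carrier P)" if c: "c \<in> carrier C" for c
  proof -
    have "inj_on (\<theta> c) (carrier P)"
    proof (rule inj_onI)
      fix x y assume xy: "x \<in> carrier P" "y \<in> carrier P" "\<theta> c x = \<theta> c y"
      then have "\<psi> c \<otimes> \<phi> x = \<psi> c \<otimes> \<phi> y" using \<phi>\<theta>[OF c] by metis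
      then have "\<phi> x = \<phi> y" using m_lcancel \<psi>c[OF c] \<phi>c xy by blast
      then show "x = y" using inj xy by blast
    qed
    moreover have "y \<in> \<theta> c ` carrier P" if y: "y \<in> carrier P" for y
    proof -
      have d: "inv\<^bsub>C\<^esub> c \<in> carrier C" using c by simp
      have "\<psi> c \<otimes> \<psi> (inv\<^bsub>C\<^esub> c) = \<psi> (c \<otimes>\<^bsub>C\<^esub> inv\<^bsub>C\<^esub> c)" using c d by (simp only: \<psi>m)
      also have "\<dots> = \<psi> \<one>\<^bsub>C\<^esub>" using c by simp
      also have "\<dots> = \<one>"
        using hom_one[OF \<psi> C field_mult_group] by simp
      finally have "\<phi> (\<theta> c (\<theta> (inv\<^bsub>C\<^esub> c) y)) = \<phi> y"
        using c d y by (simp add: cl \<phi>\<theta> \<psi>c \<phi>c flip: m_assoc)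
      then have "\<theta> c (\<theta> (inv\<^bsub>C\<^esub> c) y) = y" using c d y by (intro inj) (auto simp: cl)
      then show ?thesis using cl[OF d y] by (metis imageI)
    qed
    ultimately show ?thesis using ext cl[OF c] by (auto simp: Bij_def bij_betw_def)
  qed
  have "\<theta> \<in> hom C (AutoGroup P)"
  proof (rule homI)
    fix c assume "c \<in> carrier C"
    then show "\<theta> c \<in> carrier (AutoGroup P)"
      using hm bj by (simp add: AutoGroup_def Bij.auto_def)
  next
    fix c d assume c: "c \<in> carrier C" and d: "d \<in> carrier C"
    have "\<theta> (c \<otimes>\<^bsub>C\<^esub> d) = compose (carrier P) (\<theta> c) (\<theta> d)"
    proof (rule extensionalityI[OF ext compose_extensional])
      fix x assume x: "x \<in> carrier P"
      have "\<theta> (c \<otimes>\<^bsub>C\<^esub> d) x = \<theta> c (\<theta> d x)"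
        using c d x by (intro inj) (simp_all add: cl \<phi>\<theta> \<psi>m m_assoc \<psi>c \<phi>c)
      then show "\<theta> (c \<otimes>\<^bsub>C\<^esub> d) x = compose (carrier P) (\<theta> c) (\<theta> d) x"
        using x by (simp add: compose_def)
    qed
    then show "\<theta> (c \<otimes>\<^bsub>C\<^esub> d) = \<theta> c \<otimes>\<^bsub>AutoGroup P\<^esub> \<theta> d"
      using bj c d by (simp add: AutoGroup_def BijGroup_def)
  qed
  then show ?thesis by (simp add: \<theta>_def)
qed

end

theory Submission
  imports Defs
begin

text \<open>
  The group \<open>G\<close> acts on \<open>GF(q)\<close> by the affine maps \<open>x \<mapsto> s x + a\<close> with \<open>s\<close> a nonzero square, hence
  on the 2-element subsets of \<open>GF(q)\<close>, and this action preserves the sizes of intersections. It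
  carries \<open>{0, 1}\<close> to \<open>{a, a + s}\<close>. Since \<open>q \<equiv> 3 (mod 4)\<close>, the element \<open>-1\<close> is not a square
  (\<open>minus_square_not_square\<close>), so a pair of points is of the form \<open>{a, a + s}\<close> for at most one
  \<open>(a, s)\<close>. There are \<open>q (q - 1) / 2\<close> such \<open>(a, s)\<close> and as many pairs of points, so the action on
  pairs is regular (\<open>bij_betw_affine_pair\<close>).

  A graph with a group of automorphisms acting regularly on the vertices is a Cayley graph of that
  group (Sabidussi). Choosing a base vertex turns such an action into a labelling of the vertices by
  group elements under which left translations preserve adjacency, and
  \<open>cayley_graph_of_invariant_labelling\<close> is stated for such labellings.
\<close>

section \<open>Graphs with a regular group of automorphisms\<close>

lemma digraph_iso_with_projI:
  assumes bij: "bij_betw f (pverts \<Gamma>) (pverts \<Delta>)"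
    and wf: "parcs \<Gamma> \<subseteq> pverts \<Gamma> \<times> pverts \<Gamma>" "parcs \<Delta> \<subseteq> pverts \<Delta> \<times> pverts \<Delta>"
    and arc: "\<And>u v. u \<in> pverts \<Gamma> \<Longrightarrow> v \<in> pverts \<Gamma> \<Longrightarrow> (f u, f v) \<in> parcs \<Delta> \<longleftrightarrow> (u, v) \<in> parcs \<Gamma>"
  shows "digraph_iso (with_proj \<Gamma>) (with_proj \<Delta>)"
proof -
  define h where "h = \<lparr>iso_verts = f, iso_arcs = map_prod f f, iso_head = snd, iso_tail = fst\<rparr>"
  have inj: "inj_on f (pverts \<Gamma>)" and im: "f ` pverts \<Gamma> = pverts \<Delta>"
    using bij by (auto simp: bij_betw_def)
  have "wf_digraph (with_proj \<Gamma>)"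
    using wf(1) by unfold_locales auto
  moreover have "inj_on (map_prod f f) (parcs \<Gamma>)"
    using map_prod_inj_on[OF inj inj] wf(1) by (rule inj_on_subset)
  ultimately have "pre_digraph.digraph_isomorphism (with_proj \<Gamma>) h"
    using inj by (auto simp: pre_digraph.digraph_isomorphism_def h_def)
  moreover have "map_prod f f ` parcs \<Gamma> = parcs \<Delta>"
  proof
    show "map_prod f f ` parcs \<Gamma> \<subseteq> parcs \<Delta>"
      using wf(1) arc by auto
    show "parcs \<Delta> \<subseteq> map_prod f f ` parcs \<Gamma>"
    proof
      fix a assume a: "a \<in> parcs \<Delta>"
      then obtain u v where "u \<in> pverts \<Gamma>" "v \<in> pverts \<Gamma>" "a = (f u, f v)"
        using wf(2) im by blast
      with a arc show "a \<in> map_prod f f ` parcs \<Gamma>" by force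
    qed
  qed
  then have "with_proj \<Delta> = app_iso h (with_proj \<Gamma>)"
    using im by (simp add: app_iso_def h_def with_proj_def)
  ultimately show ?thesis unfolding digraph_iso_def by blast
qed

text \<open>In \<open>cayley_graph\<close> it is right translation that preserves adjacency, whereas the labelling
  \<open>\<beta>\<close> is invariant under left translation. The isomorphism therefore sends the vertex \<open>\<beta> g\<close> to
  \<open>inv g\<close>: the arc from \<open>\<beta> g\<close> to \<open>\<beta> h\<close> is translated by \<open>inv g\<close>, and up to symmetry it becomes
  the test whether \<open>inv g \<otimes> h\<close> labels a neighbour of the base vertex \<open>\<beta> \<one>\<close>.\<close>

lemma (in group) cayley_graph_of_invariant_labelling:
  assumes \<beta>: "bij_betw \<beta> (carrier G) (pverts \<Gamma>)"
    and wf: "parcs \<Gamma> \<subseteq> pverts \<Gamma> \<times> pverts \<Gamma>" and sym: "sym (parcs \<Gamma>)" and irrefl: "irrefl (parcs \<Gamma>)"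
    and inv: "\<And>k g h. k \<in> carrier G \<Longrightarrow> g \<in> carrier G \<Longrightarrow> h \<in> carrier G \<Longrightarrow>
      (\<beta> (k \<otimes> g), \<beta> (k \<otimes> h)) \<in> parcs \<Gamma> \<longleftrightarrow> (\<beta> g, \<beta> h) \<in> parcs \<Gamma>"
  shows "\<exists>S \<subseteq> carrier G. \<one> \<notin> S \<and> S = {inv s | s. s \<in> S} \<and>
    digraph_iso (with_proj \<Gamma>) (with_proj (cayley_graph G S))"
proof -
  define S where "S = {s \<in> carrier G. (\<beta> s, \<beta> \<one>) \<in> parcs \<Gamma>}"
  have key: "inv g \<otimes> h \<in> S \<longleftrightarrow> (\<beta> g, \<beta> h) \<in> parcs \<Gamma>"
    if "g \<in> carrier G" "h \<in> carrier G" for g h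
  proof -
    have "inv g \<otimes> h \<in> S \<longleftrightarrow> (\<beta> (inv g \<otimes> h), \<beta> (inv g \<otimes> g)) \<in> parcs \<Gamma>"
      using that by (simp add: S_def)
    also have "\<dots> \<longleftrightarrow> (\<beta> g, \<beta> h) \<in> parcs \<Gamma>"
      using that inv[of "inv g" h g] sym by (auto dest: symD)
    finally show ?thesis .
  qed
  have inv_S: "inv s \<in> S" if "s \<in> S" for s
    using that key[of s \<one>] by (simp add: S_def)
  have "S = {inv s | s. s \<in> S}"
  proof (intro equalityI subsetI)
    fix s assume "s \<in> S"
    then have "inv s \<in> S" "s = inv (inv s)" using inv_S by (auto simp: S_def)
    then show "s \<in> {inv s | s. s \<in> S}" by blast
  qed (use inv_S in blast)
  moreover have "\<one> \<notin> S" using irrefl by (simp add: S_def irrefl_def)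
  moreover have "digraph_iso (with_proj \<Gamma>) (with_proj (cayley_graph G S))"
  proof (rule digraph_iso_with_projI)
    let ?f = "\<lambda>v. inv (inv_into (carrier G) \<beta> v)"
    have bij: "bij_betw (inv_into (carrier G) \<beta>) (pverts \<Gamma>) (carrier G)"
      using \<beta> by (rule bij_betw_inv_into)
    have "bij_betw (\<lambda>g. inv g) (carrier G) (carrier G)"
      by (rule bij_betw_byWitness[where f' = "\<lambda>g. inv g"]) auto
    then show "bij_betw ?f (pverts \<Gamma>) (pverts (cayley_graph G S))"
      using bij_betw_trans[OF bij] by (simp add: cayley_graph_def comp_def)
    fix u v assume uv: "u \<in> pverts \<Gamma>" "v \<in> pverts \<Gamma>"
    then have "inv_into (carrier G) \<beta> u \<in> carrier G" "inv_into (carrier G) \<beta> v \<in> carrier G"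
      using bij by (auto simp: bij_betw_def)
    moreover have "\<beta> (inv_into (carrier G) \<beta> u) = u" "\<beta> (inv_into (carrier G) \<beta> v) = v"
      using \<beta> uv by (simp_all add: bij_betw_inv_into_right)
    ultimately show "(?f u, ?f v) \<in> parcs (cayley_graph G S) \<longleftrightarrow> (u, v) \<in> parcs \<Gamma>"
      by (simp add: cayley_graph_def key)
  qed (use wf in \<open>auto simp: cayley_graph_def\<close>)
  moreover have "S \<subseteq> carrier G" by (auto simp: S_def)
  ultimately show ?thesis by blast
qed

section \<open>Nonzero squares in a field of order 3 modulo 4\<close>

context field
begin

text \<open>Otherwise \<open>\<one>\<close> would have order 2 in the additive group, whose order is odd.\<close>

lemma minus_one_neq_one:
  assumes "odd (order R)"
  shows "\<ominus> \<one> \<noteq> \<one>"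
proof
  assume "\<ominus> \<one> = \<one>"
  then have "\<one> \<oplus> \<one> = \<zero>" by (metis one_closed r_neg)
  then have "\<one> [^]\<^bsub>add_monoid R\<^esub> (2 :: nat) = \<one>\<^bsub>add_monoid R\<^esub>"
    by (simp add: numeral_2_eq_2)
  then have "group.ord (add_monoid R) \<one> dvd 2"
    using group.pow_eq_id[OF a_group, of \<one> 2] by simp
  moreover have "group.ord (add_monoid R) \<one> dvd order R"
    using group.ord_dvd_group_order[OF a_group, of \<one>] by (simp add: order_def)
  ultimately have "group.ord (add_monoid R) \<one> = 1"
    using assms by (metis dvd_trans even_Suc_div_two dvd_refl one_dvd prime_nat_iff two_is_prime_nat)
  then show False
    using group.ord_eq_1[OF a_group, of \<one>] by simp
qed

lemma carrier_nonzero_squares_group: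
  "carrier (nonzero_squares_group R) = {x \<otimes> x | x. x \<in> carrier R - {\<zero>}}"
  by (simp add: nonzero_squares_group_def)

lemma nonzero_squares_subset: "carrier (nonzero_squares_group R) \<subseteq> carrier R - {\<zero>}"
  by (auto simp: carrier_nonzero_squares_group integral_iff)

lemma card_nonzero_squares:
  assumes "odd (order R)"
  shows "card (carrier (nonzero_squares_group R)) = (order R - 1) div 2"
proof -
  obtain \<psi> where "bij_betw \<psi> (carrier (integer_mod_group ((order R - 1) div 2)))
      (carrier (nonzero_squares_group R))"
    using nonzero_squares_group_identification[OF assms] by (auto simp: iso_def)
  then have "card (carrier (nonzero_squares_group R)) =
      card (carrier (integer_mod_group ((order R - 1) div 2)))"
    by (simp add: bij_betw_same_card)
  then show ?thesis by (simp add: carrier_integer_mod_group infinite_UNIV_int)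
qed

text \<open>A nonzero square raised to the power \<open>(q - 1) / 2\<close> gives \<open>\<one>\<close>, whereas this exponent is odd,
  so that the power of its negative is \<open>\<ominus> \<one>\<close>.\<close>

lemma minus_square_not_square:
  assumes ord: "[order R = 3] (mod 4)"
    and s: "s \<in> carrier (nonzero_squares_group R)"
  shows "\<ominus> s \<notin> carrier (nonzero_squares_group R)"
proof
  assume ms: "\<ominus> s \<in> carrier (nonzero_squares_group R)"
  define t where "t = (order R - 1) div 2"
  have m: "order R mod 4 = 3" using ord by (simp add: cong_def)
  have t: "odd t" "order R = 2 * t + 1" unfolding t_def using m by presburger+
  then have fin: "finite (carrier R)" by (metis order_def card.infinite add_is_0 zero_neq_one)
  have pow: "u [^] t = \<one>" if u: "u \<in> carrier (nonzero_squares_group R)" for u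
  proof -
    obtain x where x: "x \<in> carrier R - {\<zero>}" "u = x \<otimes> x"
      using u by (auto simp: carrier_nonzero_squares_group)
    have "x [^] order (mult_of R) = \<one>"
      using group.pow_order_eq_1[OF field_mult_group, of x] x by (simp add: nat_pow_mult_of)
    moreover have "order (mult_of R) = t + t"
      using t(2) fin by (simp add: order_def card_Diff_singleton)
    ultimately show ?thesis
      using x by (simp add: nat_pow_distrib nat_pow_mult)
  qed
  have sc: "s \<in> carrier R" using s nonzero_squares_subset by blast
  obtain k where k: "t = 2 * k + 1" using t(1) by (rule oddE)
  have "(\<ominus> s) [^] (2 :: nat) = s [^] (2 :: nat)"
    using sc by (simp add: numeral_2_eq_2 l_minus r_minus)
  then have "(\<ominus> s) [^] (2 * k) = s [^] (2 * k)"
    using sc by (metis nat_pow_pow a_inv_closed)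
  then have "(\<ominus> s) [^] t = \<ominus> (s [^] t)"
    using sc k by (simp add: r_minus)
  then have "\<one> = \<ominus> \<one>"
    using pow[OF s] pow[OF ms] by simp
  moreover have "odd (order R)" using t(2) by simp
  ultimately show False using minus_one_neq_one by simp
qed

section \<open>The regular action on pairs of field elements\<close>

text \<open>This is the image of \<open>{\<zero>, \<one>}\<close> under the affine map \<open>x \<mapsto> \<psi> c \<otimes> x \<oplus> \<phi> n\<close>.\<close>

definition affine_pair :: "('p \<Rightarrow> 'a) \<Rightarrow> ('q \<Rightarrow> 'a) \<Rightarrow> 'p \<times> 'q \<Rightarrow> 'a set"
  where "affine_pair \<phi> \<psi> = (\<lambda>(n, c). {\<phi> n, \<phi> n \<oplus> \<psi> c})"

text \<open>For injectivity, two pairs \<open>{a, a + s}\<close> and \<open>{b, b + u}\<close> can coincide with \<open>a \<noteq> b\<close> only if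
  \<open>u = -s\<close>, which is excluded because \<open>-1\<close> is not a square. Surjectivity follows by counting.\<close>

lemma bij_betw_affine_pair:
  assumes ord: "[order R = 3] (mod 4)"
    and \<phi>: "bij_betw \<phi> P (carrier R)"
    and \<psi>: "bij_betw \<psi> C (carrier (nonzero_squares_group R))"
  shows "bij_betw (affine_pair \<phi> \<psi>) (P \<times> C) {A. A \<subseteq> carrier R \<and> card A = 2}"
proof -
  have m: "order R mod 4 = 3" using ord by (simp add: cong_def)
  then have odd: "odd (order R)" by presburger
  then have fin: "finite (carrier R)" by (metis order_def card.infinite even_zero)
  have \<phi>c: "\<phi> n \<in> carrier R" if "n \<in> P" for n
    using \<phi> that by (auto simp: bij_betw_def)
  have \<psi>s: "\<psi> c \<in> carrier (nonzero_squares_group R)" if "c \<in> C" for c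
    using \<psi> that by (auto simp: bij_betw_def)
  then have \<psi>c: "\<psi> c \<in> carrier R" "\<psi> c \<noteq> \<zero>" if "c \<in> C" for c
    using that nonzero_squares_subset by blast+
  have inj: "inj_on (affine_pair \<phi> \<psi>) (P \<times> C)"
  proof (rule inj_onI, clarify)
    fix n c n' c' assume P: "n \<in> P" "n' \<in> P" and C: "c \<in> C" "c' \<in> C"
      and "affine_pair \<phi> \<psi> (n, c) = affine_pair \<phi> \<psi> (n', c')"
    then have eq: "{\<phi> n, \<phi> n \<oplus> \<psi> c} = {\<phi> n', \<phi> n' \<oplus> \<psi> c'}" by (simp add: affine_pair_def)
    then consider "\<phi> n = \<phi> n'" "\<phi> n \<oplus> \<psi> c = \<phi> n' \<oplus> \<psi> c'"
      | "\<phi> n = \<phi> n' \<oplus> \<psi> c'" "\<phi> n \<oplus> \<psi> c = \<phi> n'"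
      unfolding doubleton_eq_iff by blast
    then show "n = n' \<and> c = c'"
    proof cases
      case 1
      then have "\<psi> c = \<psi> c'" using \<phi>c[OF P(2)] \<psi>c C by simp
      with 1 show ?thesis using \<phi> \<psi> P C by (auto simp: bij_betw_def dest: inj_onD)
    next
      case 2
      then have "\<phi> n = \<phi> n \<oplus> (\<psi> c \<oplus> \<psi> c')"
        using \<phi>c[OF P(1)] \<psi>c C by (metis a_assoc)
      then have "\<psi> c \<oplus> \<psi> c' = \<zero>"
        using \<phi>c[OF P(1)] \<psi>c C by simp
      then have "\<psi> c' = \<ominus> \<psi> c" using \<psi>c C by (metis a_comm minus_equality)
      then show ?thesis using minus_square_not_square[OF ord \<psi>s[OF C(1)]] \<psi>s[OF C(2)] by simp
    qed
  qed
  have "affine_pair \<phi> \<psi> ` (P \<times> C) = {A. A \<subseteq> carrier R \<and> card A = 2}"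
  proof (rule card_subset_eq)
    show "finite {A. A \<subseteq> carrier R \<and> card A = 2}" using fin by simp
    have "card {\<phi> n, \<phi> n \<oplus> \<psi> c} = 2" if "n \<in> P" "c \<in> C" for n c
    proof -
      have "\<phi> n \<noteq> \<phi> n \<oplus> \<psi> c"
        using \<phi>c[OF that(1)] \<psi>c[OF that(2)] by simp
      then show ?thesis by simp
    qed
    then show "affine_pair \<phi> \<psi> ` (P \<times> C) \<subseteq> {A. A \<subseteq> carrier R \<and> card A = 2}"
      using \<phi>c \<psi>c by (auto simp: affine_pair_def)
    have "card (affine_pair \<phi> \<psi> ` (P \<times> C)) = card P * card C"
      using inj by (simp add: card_image card_cartesian_product)
    also have "\<dots> = order R * ((order R - 1) div 2)"
      using bij_betw_same_card[OF \<phi>] bij_betw_same_card[OF \<psi>] card_nonzero_squares[OF odd]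
      by (simp add: order_def)
    also have "\<dots> = order R choose 2"
      using odd by (simp add: choose_two div_mult_swap)
    finally show "card (affine_pair \<phi> \<psi> ` (P \<times> C)) = card {A. A \<subseteq> carrier R \<and> card A = 2}"
      using fin by (simp add: n_subsets order_def)
  qed
  with inj show ?thesis by (simp add: bij_betw_def)
qed

text \<open>The product in the semidirect product is the composition of affine maps, so left multiplication
  moves a pair by an affine permutation. Intersection sizes are therefore invariant under left
  translation.\<close>

lemma affine_pair_mult:
  assumes \<phi>: "\<phi> \<in> iso P (add_monoid R)" and \<psi>: "\<psi> \<in> hom C (mult_of R)"
    and x: "m \<in> carrier P" "d \<in> carrier C" "g \<in> carrier P \<times> carrier C"
  shows "affine_pair \<phi> \<psi> ((m, d) \<otimes>\<^bsub>semidirect_product P C (multiplication_action R P \<phi> \<psi>)\<^esub> g) =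
    (\<lambda>x. \<phi> m \<oplus> \<psi> d \<otimes> x) ` affine_pair \<phi> \<psi> g"
proof -
  obtain n c where g: "g = (n, c)" "n \<in> carrier P" "c \<in> carrier C" using x(3) by auto
  have bij: "bij_betw \<phi> (carrier P) (carrier R)"
    and add: "\<And>x y. x \<in> carrier P \<Longrightarrow> y \<in> carrier P \<Longrightarrow> \<phi> (x \<otimes>\<^bsub>P\<^esub> y) = \<phi> x \<oplus> \<phi> y"
    using \<phi> by (auto simp: iso_def hom_def)
  have \<phi>c: "\<phi> x \<in> carrier R" if "x \<in> carrier P" for x
    using bij that by (auto simp: bij_betw_def)
  have \<psi>c: "\<psi> c \<in> carrier R" if "c \<in> carrier C" for c
    using hom_in_carrier[OF \<psi> that] by auto
  define n' where "n' = multiplication_action R P \<phi> \<psi> d n"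
  have im: "\<psi> d \<otimes> \<phi> n \<in> \<phi> ` carrier P"
    using bij \<phi>c[OF g(2)] \<psi>c[OF x(2)] by (auto simp: bij_betw_def)
  have n': "n' = inv_into (carrier P) \<phi> (\<psi> d \<otimes> \<phi> n)"
    using g by (simp add: n'_def multiplication_action_def)
  have "n' \<in> carrier P" "\<phi> n' = \<psi> d \<otimes> \<phi> n"
    unfolding n' using im by (rule inv_into_into, rule f_inv_into_f)
  moreover have "(m, d) \<otimes>\<^bsub>semidirect_product P C (multiplication_action R P \<phi> \<psi>)\<^esub> g =
      (m \<otimes>\<^bsub>P\<^esub> n', d \<otimes>\<^bsub>C\<^esub> c)"
    by (simp add: semidirect_product_def g n'_def)
  moreover have "\<psi> (d \<otimes>\<^bsub>C\<^esub> c) = \<psi> d \<otimes> \<psi> c"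
    using hom_mult[OF \<psi> x(2) g(3)] by simp
  ultimately show ?thesis
    using x g \<phi>c \<psi>c by (simp add: affine_pair_def add r_distr a_assoc)
qed

lemma inj_on_affine_map:
  assumes "a \<in> carrier R" "s \<in> carrier R - {\<zero>}"
  shows "inj_on (\<lambda>x. a \<oplus> s \<otimes> x) (carrier R)"
  using assms by (auto intro!: inj_onI simp: m_lcancel)

end

section \<open>The triangular graph as a Cayley graph\<close>

lemma triangular_graph_simps:
  "pverts (triangular_graph n) = {A. A \<subseteq> {..<n} \<and> card A = 2}"
  "(A, B) \<in> parcs (triangular_graph n) \<longleftrightarrow>
    A \<in> pverts (triangular_graph n) \<and> B \<in> pverts (triangular_graph n) \<and> card (A \<inter> B) = 1"
  by (auto simp: triangular_graph_def Let_def)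

lemma bij_betw_image_subsets_card:
  assumes "bij_betw e X Y"
  shows "bij_betw ((`) e) {A. A \<subseteq> X \<and> card A = k} {B. B \<subseteq> Y \<and> card B = k}"
proof -
  have inj: "inj_on e X" and im: "e ` X = Y" using assms by (auto simp: bij_betw_def)
  have card: "card (e ` A) = card A" if "A \<subseteq> X" for A
    using inj that by (meson card_image inj_on_subset)
  have "inj_on ((`) e) {A. A \<subseteq> X \<and> card A = k}"
    using inj_on_image_Pow[OF inj] by (rule inj_on_subset) auto
  moreover have "B \<in> (`) e ` {A. A \<subseteq> X \<and> card A = k}" if "B \<subseteq> Y" "card B = k" for B
    using that im card by (auto simp: subset_image_iff)
  ultimately show ?thesis using im card by (auto simp: bij_betw_def)
qed

lemma (in field) triangular_graph_cayley:
  assumes ord: "[order R = 3] (mod 4)"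
    and P: "group P" and C: "group C"
    and \<phi>: "\<phi> \<in> iso P (add_monoid R)" and \<psi>: "\<psi> \<in> iso C (nonzero_squares_group R)"
    and G: "G = semidirect_product P C (multiplication_action R P \<phi> \<psi>)"
  shows "\<exists>S \<subseteq> carrier G. \<one>\<^bsub>G\<^esub> \<notin> S \<and> S = {inv\<^bsub>G\<^esub> s | s. s \<in> S} \<and>
    digraph_iso (with_proj (triangular_graph (order R))) (with_proj (cayley_graph G S))"
proof -
  have "order R \<noteq> 0" using ord by (auto simp: cong_def)
  then have fin: "finite (carrier R)" by (metis order_def card.infinite)
  have \<psi>s: "\<psi> \<in> hom C (nonzero_squares_group R)" using \<psi> by (simp add: iso_def)
  have \<psi>h: "\<psi> \<in> hom C (mult_of R)"
  proof (rule homI)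
    fix c assume "c \<in> carrier C"
    then show "\<psi> c \<in> carrier (mult_of R)"
      using hom_in_carrier[OF \<psi>s] nonzero_squares_subset by (metis carrier_mult_of subsetD)
  next
    fix c d assume "c \<in> carrier C" "d \<in> carrier C"
    then show "\<psi> (c \<otimes>\<^bsub>C\<^esub> d) = \<psi> c \<otimes>\<^bsub>mult_of R\<^esub> \<psi> d"
      using hom_mult[OF \<psi>s] by (simp add: nonzero_squares_group_def)
  qed
  interpret G: group G
    unfolding G by (intro group_semidirect_product multiplication_action_hom P C \<phi> \<psi>h)
  have car: "carrier G = carrier P \<times> carrier C" by (simp add: G semidirect_product_def)
  have pair: "bij_betw (affine_pair \<phi> \<psi>) (carrier G) {A. A \<subseteq> carrier R \<and> card A = 2}"
    unfolding car using \<phi> \<psi> by (intro bij_betw_affine_pair ord) (auto simp: iso_def)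
  obtain e where e: "bij_betw e (carrier R) {..<order R}"
    using ex_bij_betw_finite_nat[OF fin] by (auto simp: order_def atLeast0LessThan)
  define \<beta> where "\<beta> g = e ` affine_pair \<phi> \<psi> g" for g
  have \<beta>: "bij_betw \<beta> (carrier G) (pverts (triangular_graph (order R)))"
    using bij_betw_trans[OF pair bij_betw_image_subsets_card[OF e]]
    by (simp add: \<beta>_def [abs_def] triangular_graph_simps(1) comp_def)
  have sub: "affine_pair \<phi> \<psi> g \<subseteq> carrier R" if "g \<in> carrier G" for g
    using pair that by (auto simp: bij_betw_def)
  have arc: "(\<beta> g, \<beta> h) \<in> parcs (triangular_graph (order R)) \<longleftrightarrow>
      card (affine_pair \<phi> \<psi> g \<inter> affine_pair \<phi> \<psi> h) = 1"
    if gh: "g \<in> carrier G" "h \<in> carrier G" for g h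
  proof -
    have inj: "inj_on e (carrier R)" using e by (simp add: bij_betw_def)
    have "\<beta> g \<inter> \<beta> h = e ` (affine_pair \<phi> \<psi> g \<inter> affine_pair \<phi> \<psi> h)"
      by (simp add: \<beta>_def inj_on_image_Int[OF inj sub[OF gh(1)] sub[OF gh(2)]])
    moreover have "inj_on e (affine_pair \<phi> \<psi> g \<inter> affine_pair \<phi> \<psi> h)"
      using inj sub[OF gh(1)] by (blast intro: inj_on_subset)
    moreover have "\<beta> g \<in> pverts (triangular_graph (order R))" "\<beta> h \<in> pverts (triangular_graph (order R))"
      using \<beta> gh by (auto simp: bij_betw_def)
    ultimately show ?thesis
      by (simp add: triangular_graph_simps(2) card_image)
  qed
  show ?thesis
  proof (rule G.cayley_graph_of_invariant_labelling[OF \<beta>])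
    fix k g h assume k: "k \<in> carrier G" and g: "g \<in> carrier G" and h: "h \<in> carrier G"
    obtain m d where md: "k = (m, d)" "m \<in> carrier P" "d \<in> carrier C" using k car by auto
    define f where "f x = \<phi> m \<oplus> \<psi> d \<otimes> x" for x
    have "\<phi> m \<in> carrier R" "\<psi> d \<in> carrier R - {\<zero>}"
      using \<phi> md hom_in_carrier[OF \<psi>h md(3)] by (auto simp: iso_def bij_betw_def)
    then have inj: "inj_on f (carrier R)" unfolding f_def by (rule inj_on_affine_map)
    have img: "affine_pair \<phi> \<psi> (k \<otimes>\<^bsub>G\<^esub> u) = f ` affine_pair \<phi> \<psi> u" if "u \<in> carrier G" for u
      using affine_pair_mult[OF \<phi> \<psi>h md(2,3)] that by (simp add: car f_def md(1) flip: G)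
    have "affine_pair \<phi> \<psi> (k \<otimes>\<^bsub>G\<^esub> g) \<inter> affine_pair \<phi> \<psi> (k \<otimes>\<^bsub>G\<^esub> h) =
        f ` (affine_pair \<phi> \<psi> g \<inter> affine_pair \<phi> \<psi> h)"
      by (simp add: img g h inj_on_image_Int[OF inj sub[OF g] sub[OF h]])
    moreover have "inj_on f (affine_pair \<phi> \<psi> g \<inter> affine_pair \<phi> \<psi> h)"
      using inj sub[OF g] by (blast intro: inj_on_subset)
    ultimately show "(\<beta> (k \<otimes>\<^bsub>G\<^esub> g), \<beta> (k \<otimes>\<^bsub>G\<^esub> h)) \<in> parcs (triangular_graph (order R)) \<longleftrightarrow>
        (\<beta> g, \<beta> h) \<in> parcs (triangular_graph (order R))"
      using k g h by (simp add: arc card_image)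
  next
    show "irrefl (parcs (triangular_graph (order R)))"
      by (auto simp: irrefl_def triangular_graph_simps)
    show "sym (parcs (triangular_graph (order R)))"
      by (auto simp: sym_def triangular_graph_simps Int_commute)
    show "parcs (triangular_graph (order R)) \<subseteq>
        pverts (triangular_graph (order R)) \<times> pverts (triangular_graph (order R))"
      by (auto simp: triangular_graph_simps(2))
  qed
qed

theorem theorem4p8:
  fixes p r q t :: nat
    and F :: "('a, 'b) ring_scheme"
    and \<phi> :: "(nat \<Rightarrow> int) \<Rightarrow> 'a" and \<psi> :: "int \<Rightarrow> 'a"
    and G :: "((nat \<Rightarrow> int) \<times> int) monoid"
  assumes "prime p" and "r \<ge> 1" and "q = p ^ r" and "[q = 3] (mod 4)"
    and "t = (q - 1) div 2"
    and "field F" and "order F = q"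
    and "\<phi> \<in> iso (elementary_abelian_group p r) (add_monoid F)"
    and "\<psi> \<in> iso (integer_mod_group t) (nonzero_squares_group F)"
    and "G = semidirect_product (elementary_abelian_group p r) (integer_mod_group t)
               (multiplication_action F (elementary_abelian_group p r) \<phi> \<psi>)"
  shows "\<exists>S \<subseteq> carrier G. \<one>\<^bsub>G\<^esub> \<notin> S \<and> S = {inv\<^bsub>G\<^esub> s | s. s \<in> S} \<and>
           digraph_iso (with_proj (triangular_graph q)) (with_proj (cayley_graph G S))"
proof -
  have "group (elementary_abelian_group p r)" by simp
  from field.triangular_graph_cayley[OF assms(6) _ this group_integer_mod_group assms(8-10)]
  show ?thesis using assms(4,7) by simp
qed

end
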